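(* Let $G$ be a $P_4$-free graph. Then $G$ is non-trivially minimally tough if and only if $G$ is isomorphic to one of the graphs $K_{2,3}$, $K_{1,\ell}$, $T_{2\ell,\ell}$, or $T_{2\ell-1,\ell}$, for some integer $\ell \geq 2$.
   Context: All graphs are finite, simple, and undirected. A graph is $P_4$-free if it has no induced subgraph isomorphic to the four-vertex path $P_4$. For a graph $H$, $c(H)$ denotes the number of connected components of $H$. A set $S\subseteq V(G)$ is a separator of $G$ if $c(G-S)\ge 2$. The toughness $\tau(G)$ of a graph $G$ is the minimum of $|S|/c(G-S)$ over all separators $S$ of $G$, with $\tau(G)=\infty$ if $G$ has no separators, that is, if $G$ is complete. (Disconnected graphs have toughness $0$.) For $t\in\mathbb{R}\cup\{\infty\}$, $G$ is minimally $t$-tough if $\tau(G)=t$ and $\tau(G-e)<t$ for every edge $e$ of $G$ ($G-e$ is obtained by deleting the edge $e$). $G$ is minimally tough if it is minimally $t$-tough for some $t\in\mathbb{R}\cup\{\infty\}$. Complete graphs and edgeless graphs are trivially minimally tough; all other minimally tough graphs are called non-trivially minimally tough. $K_{m,n}$ is the complete bipartite graph with parts of sizes $m$ and $n$. A complete multipartite graph is one whose vertex set can be partitioned into parts such that two distinct vertices are adjacent iff they belong to different parts. $T_{n,k}$ denotes the complete multipartite graph with $n$ vertices and $k$ parts whose sizes are as equal as possible; thus all parts of $T_{2\ell,\ell}$ have size $2$, and all parts of $T_{2\ell-1,\ell}$ have size $2$ except one of size $1$. *)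

theory Defs
  imports Complex_Main "HOL-Library.Extended_Real" "HOL-Library.Disjoint_Sets"
begin

record 'a ugraph =
  verts :: "'a set"
  edges :: "'a set set"

definition simple_graph :: "'a ugraph \<Rightarrow> bool" where
  "simple_graph G \<longleftrightarrow> finite (verts G) \<and> (\<forall>e\<in>edges G. e \<subseteq> verts G \<and> card e = 2)"

definition adjacent :: "'a ugraph \<Rightarrow> 'a \<Rightarrow> 'a \<Rightarrow> bool" where
  "adjacent G u v \<longleftrightarrow> {u, v} \<in> edges G"

definition induced :: "'a ugraph \<Rightarrow> 'a set \<Rightarrow> 'a ugraph" where
  "induced G W = \<lparr>verts = W, edges = {e \<in> edges G. e \<subseteq> W}\<rparr>"

definition del_verts :: "'a ugraph \<Rightarrow> 'a set \<Rightarrow> 'a ugraph" where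
  "del_verts G S = induced G (verts G - S)"

definition del_edge :: "'a ugraph \<Rightarrow> 'a set \<Rightarrow> 'a ugraph" where
  "del_edge G e = G\<lparr>edges := edges G - {e}\<rparr>"

definition graph_iso :: "'a ugraph \<Rightarrow> 'b ugraph \<Rightarrow> bool" (infix "\<cong>\<^sub>g" 50) where
  "G \<cong>\<^sub>g H \<longleftrightarrow> (\<exists>f. bij_betw f (verts G) (verts H) \<and>
     (\<forall>u\<in>verts G. \<forall>v\<in>verts G. adjacent G u v \<longleftrightarrow> adjacent H (f u) (f v)))"

definition P4 :: "nat ugraph" where
  "P4 = \<lparr>verts = {0, 1, 2, 3}, edges = {{0, 1}, {1, 2}, {2, 3}}\<rparr>"

definition P4_free :: "'a ugraph \<Rightarrow> bool" where
  "P4_free G \<longleftrightarrow> \<not> (\<exists>W \<subseteq> verts G. induced G W \<cong>\<^sub>g P4)"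

definition joined :: "'a ugraph \<Rightarrow> ('a \<times> 'a) set" where
  "joined G = {(u, v). u \<in> verts G \<and> v \<in> verts G \<and> (adjacent G)\<^sup>*\<^sup>* u v}"

definition components :: "'a ugraph \<Rightarrow> 'a set set" where
  "components G = verts G // joined G"

definition num_components :: "'a ugraph \<Rightarrow> nat" where
  "num_components G = card (components G)"

definition separator :: "'a ugraph \<Rightarrow> 'a set \<Rightarrow> bool" where
  "separator G S \<longleftrightarrow> S \<subseteq> verts G \<and> num_components (del_verts G S) \<ge> 2"

definition toughness :: "'a ugraph \<Rightarrow> ereal" where
  "toughness G =
     (if \<exists>S. separator G S
      then ereal (Min {real (card S) / real (num_components (del_verts G S)) | S. separator G S})
      else \<infinity>)"

definition minimally_t_tough :: "ereal \<Rightarrow> 'a ugraph \<Rightarrow> bool" where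
  "minimally_t_tough t G \<longleftrightarrow>
     toughness G = t \<and> (\<forall>e\<in>edges G. toughness (del_edge G e) < t)"

definition minimally_tough :: "'a ugraph \<Rightarrow> bool" where
  "minimally_tough G \<longleftrightarrow> (\<exists>t. t \<noteq> -\<infinity> \<and> minimally_t_tough t G)"

definition complete_graph :: "'a ugraph \<Rightarrow> bool" where
  "complete_graph G \<longleftrightarrow> (\<forall>u\<in>verts G. \<forall>v\<in>verts G. u \<noteq> v \<longrightarrow> adjacent G u v)"

definition edgeless :: "'a ugraph \<Rightarrow> bool" where
  "edgeless G \<longleftrightarrow> edges G = {}"

definition nontrivially_minimally_tough :: "'a ugraph \<Rightarrow> bool" where
  "nontrivially_minimally_tough G \<longleftrightarrow>
     minimally_tough G \<and> \<not> complete_graph G \<and> \<not> edgeless G"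

definition complete_multipartite :: "'a set set \<Rightarrow> 'a ugraph" where
  "complete_multipartite P =
     \<lparr>verts = \<Union>P, edges = {{u, v} | u v A B. A \<in> P \<and> B \<in> P \<and> A \<noteq> B \<and> u \<in> A \<and> v \<in> B}\<rparr>"

definition complete_bipartite :: "nat \<Rightarrow> nat \<Rightarrow> nat ugraph" where
  "complete_bipartite m n = complete_multipartite {{0..<m}, {m..<m + n}}"

text \<open>The parts of \<open>T\<^sub>n\<^sub>,\<^sub>k\<close> are the residue classes modulo \<open>k\<close> on \<open>{0..<n}\<close>;
  for \<open>1 \<le> k \<le> n\<close> the lemma \<open>turan_parts\<close> below shows that these are \<open>k\<close> non-empty parts with
  sizes as equal as possible.\<close>

definition turan_part :: "nat \<Rightarrow> nat \<Rightarrow> nat \<Rightarrow> nat set" where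
  "turan_part n k r = {i. i < n \<and> i mod k = r}"

definition turan_graph :: "nat \<Rightarrow> nat \<Rightarrow> nat ugraph" where
  "turan_graph n k = complete_multipartite (turan_part n k ` {0..<k})"

lemma card_turan_part:
  assumes "r < k"
  shows "card (turan_part n k r) = n div k + (if r < n mod k then 1 else 0)"
proof -
  have eq: "turan_part n k r = (\<lambda>q. q * k + r) ` {q. q * k + r < n}" (is "_ = ?f ` ?Q")
    unfolding turan_part_def using assms by (auto simp: image_iff) (metis div_mult_mod_eq)
  have Q: "?Q = {..<n div k + (if r < n mod k then 1 else 0)}"
  proof (intro set_eqI)
    fix q
    have n: "n = (n div k) * k + n mod k" and b: "n mod k < k"
      using assms by auto
    consider "q < n div k" | "q = n div k" | "q > n div k" by linarith
    then show "q \<in> ?Q \<longleftrightarrow> q \<in> {..<n div k + (if r < n mod k then 1 else 0)}"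
    proof cases
      case 1
      then have "Suc q * k \<le> (n div k) * k" by (intro mult_right_mono) auto
      then have "q * k + k \<le> (n div k) * k" by simp
      then have "q * k + r < n" using n assms by linarith
      then show ?thesis using 1 by simp
    next
      case 2
      then have "q * k + r < q * k + n mod k \<longleftrightarrow> q * k + r < n" using n by simp
      then have "q * k + r < n \<longleftrightarrow> r < n mod k" by simp
      then show ?thesis using 2 by simp
    next
      case 3
      then have "Suc (n div k) * k \<le> q * k" by (intro mult_right_mono) auto
      then have "(n div k) * k + k \<le> q * k" by simp
      then have "\<not> q * k + r < n" using n b by linarith
      then show ?thesis using 3 by simp
    qed
  qed
  have "inj_on ?f ?Q" using assms by (auto simp: inj_on_def)
  then show ?thesis unfolding eq by (subst card_image) (simp_all only: Q card_lessThan)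
qed

lemma turan_parts:
  assumes "1 \<le> k" "k \<le> n"
  shows "partition_on {0..<n} (turan_part n k ` {0..<k})"
    and "card (turan_part n k ` {0..<k}) = k"
    and "\<And>A B. A \<in> turan_part n k ` {0..<k} \<Longrightarrow> B \<in> turan_part n k ` {0..<k} \<Longrightarrow>
           card A \<le> card B + 1"
proof -
  have mem: "r \<in> turan_part n k r" if "r < k" for r
    using that assms by (simp add: turan_part_def)
  have "inj_on (turan_part n k) {0..<k}"
    using mem by (auto simp: inj_on_def turan_part_def set_eq_iff) (metis assms(2) less_le_trans mod_less)
  then show "card (turan_part n k ` {0..<k}) = k" by (simp add: card_image)
  show "partition_on {0..<n} (turan_part n k ` {0..<k})"
  proof (rule partition_onI)
    show "\<Union> (turan_part n k ` {0..<k}) = {0..<n}"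
      using assms by (auto simp: turan_part_def)
    show "disjnt p q" if "p \<in> turan_part n k ` {0..<k}" "q \<in> turan_part n k ` {0..<k}" "p \<noteq> q" for p q
      using that by (auto simp: turan_part_def disjnt_def)
    show "{} \<notin> turan_part n k ` {0..<k}"
      using mem by fastforce
  qed
  show "card A \<le> card B + 1"
    if "A \<in> turan_part n k ` {0..<k}" "B \<in> turan_part n k ` {0..<k}" for A B
    using that by (auto simp: card_turan_part)
qed

end

theory Submission
  imports Defs "HOL-Library.Multiset"
begin

text \<open>
  Throughout, \<open>t\<close> is the toughness of a non-complete minimally tough \<open>P\<^sub>4\<close>-free graph \<open>G\<close> on
  \<open>n\<close> vertices, \<open>N(v)\<close> is the neighbourhood of \<open>v\<close>, and \<open>c(H)\<close> counts the components of \<open>H\<close>.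
  The edges of \<open>G\<close> force \<open>t > 0\<close>, so \<open>G\<close> is connected.

  The whole argument is about degrees. A vertex \<open>v\<close> with a non-neighbour satisfies \<open>2t \<le> |N(v)|\<close>,
  because \<open>N(v)\<close> separates the two. In the other direction, call \<open>v\<close> low if \<open>|N(v)| < 2t + 1\<close>.
  Consider an edge \<open>uv\<close> whose ends together dominate \<open>G\<close>. Deleting it lowers the toughness, so some
  \<open>T\<close> has \<open>|T| < t c(G - uv - T)\<close>. Domination leaves only the components of \<open>u\<close> and of \<open>v\<close>,
  hence \<open>|T| < 2t\<close>, and \<open>uv\<close> is a bridge of \<open>G - T\<close>. A further neighbour of \<open>u\<close> and a further
  neighbour of \<open>v\<close> outside \<open>T\<close> would make an induced \<open>P\<^sub>4\<close>, so one end has all its other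
  neighbours in \<open>T\<close> and is low (\<open>dominating_edge_has_low_end\<close>).

  In a \<open>P\<^sub>4\<close>-free graph, a minimal separator \<open>S\<close> among those avoiding two given non-adjacent
  vertices is completely joined to \<open>G - S\<close> (\<open>join_separator\<close>).
  Every edge between \<open>S\<close> and the rest \<open>W\<close> is then dominating, so all of \<open>S\<close> or all of \<open>W\<close> is low; in the
  first case a separator can be chosen whose other side lies inside \<open>S\<close>. Either way some
  separator \<open>S\<close> is joined to a set \<open>W\<close> of low vertices (\<open>low_side\<close>). An edge inside \<open>W\<close> would
  give \<open>|S| + 1 < 2t + 1\<close>, against \<open>2t \<le> |S|\<close>; so \<open>W\<close> is independent and \<open>t |W| \<le> |S|\<close>.
  With \<open>|S| < 2t + 1\<close> this yields \<open>|S| (|W| - 2) < |W|\<close>, which leaves three possibilities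
  (\<open>independent_side\<close>):
  \<^item> \<open>|S| = 1\<close>, and \<open>G\<close> is a star;
  \<^item> \<open>|S| = 2\<close> and \<open>|W| = 3\<close>. The two vertices of \<open>S\<close> are not adjacent, since otherwise both would be
    adjacent to everything, and low vertices are not; so \<open>G\<close> is \<open>K\<^sub>2\<^sub>,\<^sub>3\<close>;
  \<^item> \<open>|W| = 2\<close>. Then \<open>2t > n - 3\<close>, so every vertex misses at most one other, and at most one
    vertex misses none: \<open>G\<close> is \<open>T\<^sub>2\<^sub>l\<^sub>,\<^sub>l\<close> or \<open>T\<^sub>2\<^sub>l\<^sub>-\<^sub>1\<^sub>,\<^sub>l\<close>.

  Conversely, in each listed graph all parts but possibly one have the maximal size \<open>a\<close>. A separator
  leaves a subset of a single part, so the toughness is at least \<open>(n - a) / a\<close>. Every edge has an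
  end \<open>v\<close> in a part of size \<open>a\<close>; once the edge is deleted, the \<open>n - a - 1\<close> remaining neighbours of
  \<open>v\<close> isolate it, and \<open>(n - a - 1) / 2 < (n - a) / a\<close> in all four families
  (\<open>multipartite_minimally_tough\<close>). Isomorphism with a listed graph is
  handled through the multiset of part sizes.
\<close>

section \<open>Connectivity and counting components\<close>

abbreviation reachable :: "'a ugraph \<Rightarrow> 'a \<Rightarrow> 'a \<Rightarrow> bool" where
  "reachable G \<equiv> (adjacent G)\<^sup>*\<^sup>*"

definition neighbors :: "'a ugraph \<Rightarrow> 'a \<Rightarrow> 'a set" where
  "neighbors G v = {w \<in> verts G. adjacent G v w}"

lemma adjacent_sym: "adjacent G u v \<longleftrightarrow> adjacent G v u"
  by (simp add: adjacent_def insert_commute)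

lemma not_adjacent_self: "simple_graph G \<Longrightarrow> \<not> adjacent G u u"
  by (auto simp: simple_graph_def adjacent_def)

lemma adjacent_verts: "simple_graph G \<Longrightarrow> adjacent G u v \<Longrightarrow> u \<in> verts G \<and> v \<in> verts G"
  by (auto simp: simple_graph_def adjacent_def)

lemma finite_neighbors: "simple_graph G \<Longrightarrow> finite (neighbors G v)"
  by (simp add: neighbors_def simple_graph_def)

lemma edge_endpoints:
  assumes "simple_graph G" "e \<in> edges G"
  obtains u v where "e = {u, v}" "u \<noteq> v" "u \<in> verts G" "v \<in> verts G" "adjacent G u v"
proof -
  have "card e = 2" "e \<subseteq> verts G" using assms by (auto simp: simple_graph_def)
  then obtain u v where "e = {u, v}" "u \<noteq> v" by (auto simp: card_2_iff)
  then show ?thesis using that assms \<open>e \<subseteq> verts G\<close> by (simp add: adjacent_def)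
qed

lemma verts_del_verts [simp]: "verts (del_verts G S) = verts G - S"
  by (simp add: del_verts_def induced_def)

lemma verts_del_edge [simp]: "verts (del_edge G e) = verts G"
  by (simp add: del_edge_def)

lemma adjacent_del_verts:
  "adjacent (del_verts G S) u v \<longleftrightarrow> adjacent G u v \<and> u \<in> verts G - S \<and> v \<in> verts G - S"
  by (auto simp: adjacent_def del_verts_def induced_def)

lemma adjacent_del_edge:
  "adjacent (del_edge G e) u v \<longleftrightarrow> adjacent G u v \<and> {u, v} \<noteq> e"
  by (auto simp: adjacent_def del_edge_def)

lemma simple_del_verts: "simple_graph G \<Longrightarrow> simple_graph (del_verts G S)"
  by (auto simp: simple_graph_def del_verts_def induced_def)

lemma simple_del_edge: "simple_graph G \<Longrightarrow> simple_graph (del_edge G e)"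
  by (auto simp: simple_graph_def del_edge_def)

lemma del_edge_del_verts:
  assumes "u \<in> T"
  shows "del_verts (del_edge G {u, v}) T = del_verts G T"
  using assms by (auto simp: del_verts_def del_edge_def induced_def)

lemma reachable_sym: "reachable G u v \<Longrightarrow> reachable G v u"
proof -
  have "symp (adjacent G)" by (rule sympI) (simp add: adjacent_sym)
  then show "reachable G u v \<Longrightarrow> reachable G v u" by (meson symp_rtranclp sympD)
qed

lemma equiv_joined: "equiv (verts G) (joined G)"
proof (rule equivI)
  show "sym (joined G)"
    unfolding joined_def by (rule symI) (simp add: reachable_sym)
  show "trans (joined G)"
    by (rule transI) (auto simp: joined_def)
qed (auto simp: joined_def refl_on_def)

lemma finite_components: "simple_graph G \<Longrightarrow> finite (components G)"
  unfolding components_def simple_graph_def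
  by (rule finite_quotient) (use equiv_joined[of G] in \<open>auto simp: equiv_def\<close>)

lemma two_components_iff:
  assumes "simple_graph G"
  shows "num_components G \<ge> 2 \<longleftrightarrow> (\<exists>u\<in>verts G. \<exists>v\<in>verts G. \<not> reachable G u v)"
proof
  assume "num_components G \<ge> 2"
  have "\<not> components G \<subseteq> {C}" for C
  proof
    assume "components G \<subseteq> {C}"
    then have "card (components G) \<le> card {C}" by (rule card_mono[rotated]) simp
    then show False using \<open>num_components G \<ge> 2\<close> by (simp add: num_components_def)
  qed
  note not_single = this
  obtain C where "C \<in> components G" using not_single[of undefined] by blast
  moreover obtain D where "D \<in> components G" "C \<noteq> D" using not_single[of C] by blast
  ultimately obtain u v where "u \<in> verts G" "v \<in> verts G" "C = joined G `` {u}" "D = joined G `` {v}"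
    unfolding components_def by (auto elim!: quotientE)
  moreover from this have "\<not> reachable G u v"
    using \<open>C \<noteq> D\<close> equiv_class_eq[OF equiv_joined, of u v G] by (auto simp: joined_def)
  ultimately show "\<exists>u\<in>verts G. \<exists>v\<in>verts G. \<not> reachable G u v" by blast
next
  assume "\<exists>u\<in>verts G. \<exists>v\<in>verts G. \<not> reachable G u v"
  then obtain u v where uv: "u \<in> verts G" "v \<in> verts G" "\<not> reachable G u v" by blast
  have "joined G `` {u} \<noteq> joined G `` {v}"
    using uv by (auto simp: joined_def)
  moreover have "{joined G `` {u}, joined G `` {v}} \<subseteq> components G"
    unfolding components_def using uv by (auto intro: quotientI)
  ultimately show "num_components G \<ge> 2"
    unfolding num_components_def using finite_components[OF assms]
    by (metis card_2_iff card_mono)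
qed

lemma at_most_two_components:
  assumes "\<And>w. w \<in> verts G \<Longrightarrow> reachable G w u \<or> reachable G w v"
    and "u \<in> verts G" "v \<in> verts G"
  shows "num_components G \<le> 2"
proof -
  have "components G \<subseteq> {joined G `` {u}, joined G `` {v}}"
  proof
    fix C assume "C \<in> components G"
    then obtain w where w: "w \<in> verts G" "C = joined G `` {w}"
      unfolding components_def by (auto elim!: quotientE)
    then have "(w, u) \<in> joined G \<or> (w, v) \<in> joined G"
      using assms by (auto simp: joined_def)
    then show "C \<in> {joined G `` {u}, joined G `` {v}}"
      using w equiv_class_eq[OF equiv_joined, of w u G] equiv_class_eq[OF equiv_joined, of w v G]
      by auto
  qed
  then have "num_components G \<le> card {joined G `` {u}, joined G `` {v}}"
    unfolding num_components_def by (rule card_mono[rotated]) simp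
  also have "\<dots> \<le> 2" by (simp add: card_insert_if)
  finally show ?thesis .
qed

lemma num_components_edgeless:
  assumes "\<And>u v. \<not> adjacent G u v"
  shows "num_components G = card (verts G)"
proof -
  have r: "reachable G u v \<longleftrightarrow> u = v" for u v
    using assms by (metis rtranclp.simps)
  have "components G = (\<lambda>u. {u}) ` verts G"
    unfolding components_def quotient_def by (auto simp: joined_def r)
  then show ?thesis
    by (simp add: num_components_def card_image)
qed

section \<open>Toughness as a family of inequalities\<close>

lemma finite_separator_ratios:
  assumes "simple_graph G"
  shows "finite {real (card S) / real (num_components (del_verts G S)) | S. separator G S}"
proof -
  have "{real (card S) / real (num_components (del_verts G S)) | S. separator G S}
    \<subseteq> (\<lambda>S. real (card S) / real (num_components (del_verts G S))) ` Pow (verts G)"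
    by (auto simp: separator_def)
  then show ?thesis
    using assms by (meson finite_Pow_iff finite_imageI finite_subset simple_graph_def)
qed

lemma toughness_finite:
  assumes "simple_graph G" "separator G S"
  obtains t where "toughness G = ereal t"
    and "\<And>S. separator G S \<Longrightarrow> t * num_components (del_verts G S) \<le> card S"
    and "\<exists>S. separator G S \<and> t * num_components (del_verts G S) = card S"
proof -
  let ?f = "\<lambda>S. real (card S) / real (num_components (del_verts G S))"
  let ?R = "{?f S | S. separator G S}"
  have fin: "finite ?R" by (rule finite_separator_ratios[OF assms(1)])
  have ne: "?R \<noteq> {}" using assms(2) by blast
  have pos: "real (num_components (del_verts G S)) > 0" if "separator G S" for S
    using that by (simp add: separator_def)
  have "Min ?R * num_components (del_verts G S) \<le> card S" if "separator G S" for S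
  proof -
    have "Min ?R \<le> ?f S" using fin that by (intro Min_le) auto
    then show ?thesis using pos[OF that] by (simp add: field_simps)
  qed
  moreover have "\<exists>S. separator G S \<and> Min ?R * num_components (del_verts G S) = card S"
  proof -
    obtain S where "separator G S" "Min ?R = ?f S" using Min_in[OF fin ne] by auto
    then show ?thesis using pos by (intro exI[of _ S]) (auto simp: field_simps)
  qed
  moreover have "toughness G = ereal (Min ?R)"
    using assms(2) by (auto simp: toughness_def)
  ultimately show ?thesis using that by blast
qed

lemma separator_of_nonadjacent:
  assumes "simple_graph G" "x \<in> verts G" "y \<in> verts G" "x \<noteq> y" "\<not> adjacent G x y"
  shows "separator G (verts G - {x, y})"
    and "num_components (del_verts G (verts G - {x, y})) = 2"
proof -
  have no: "\<not> adjacent (del_verts G (verts G - {x, y})) u v" for u v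
    using assms not_adjacent_self[OF assms(1)] adjacent_sym[of G x y]
    by (auto simp: adjacent_del_verts)
  have "verts G - (verts G - {x, y}) = {x, y}" using assms by auto
  then show "num_components (del_verts G (verts G - {x, y})) = 2"
    using num_components_edgeless[OF no] assms by simp
  then show "separator G (verts G - {x, y})"
    by (auto simp: separator_def)
qed

text \<open>
  Toughness itself disappears from the rest of the development: a real number \<open>t\<close> that is at most all ratios
  of \<open>G\<close> and above some ratio of every \<open>G - e\<close> certifies minimal toughness. Such a \<open>t\<close> need not be
  the toughness of \<open>G\<close>, only squeezed between that and the values for \<open>G - e\<close>; conversely the
  toughness of \<open>G\<close> is a valid \<open>t\<close>.
\<close>
lemma noncomplete_minimally_tough_iff:
  assumes "simple_graph G" "\<not> complete_graph G"
  shows "minimally_tough G \<longleftrightarrow>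
    (\<exists>t::real. (\<forall>S. separator G S \<longrightarrow> t * num_components (del_verts G S) \<le> card S) \<and>
       (\<forall>e\<in>edges G. \<exists>S. separator (del_edge G e) S \<and>
          card S < t * num_components (del_verts (del_edge G e) S)))"
    (is "_ \<longleftrightarrow> (\<exists>t. ?tough t \<and> ?fragile t)")
proof -
  obtain x y where "x \<in> verts G" "y \<in> verts G" "x \<noteq> y" "\<not> adjacent G x y"
    using assms(2) by (auto simp: complete_graph_def)
  then obtain t where t: "toughness G = ereal t" "?tough t"
    and attained: "\<exists>S. separator G S \<and> t * num_components (del_verts G S) = card S"
    using toughness_finite[OF assms(1) separator_of_nonadjacent(1)[OF assms(1)]] by metis
  have less: "toughness (del_edge G e) < ereal r \<longleftrightarrow> (\<exists>S. separator (del_edge G e) S \<and>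
          card S < r * num_components (del_verts (del_edge G e) S))" for e and r :: real
  proof (cases "\<exists>S. separator (del_edge G e) S")
    case True
    then obtain q where q: "toughness (del_edge G e) = ereal q"
      "\<And>S. separator (del_edge G e) S \<Longrightarrow> q * num_components (del_verts (del_edge G e) S) \<le> card S"
      "\<exists>S. separator (del_edge G e) S \<and> q * num_components (del_verts (del_edge G e) S) = card S"
      using toughness_finite[OF simple_del_edge[OF assms(1)]] by metis
    have pos: "real (num_components (del_verts (del_edge G e) S)) > 0"
      if "separator (del_edge G e) S" for S
      using that by (simp add: separator_def)
    show ?thesis
    proof
      assume "toughness (del_edge G e) < ereal r"
      then have "q < r" using q(1) by simp
      then show "\<exists>S. separator (del_edge G e) S \<and>
          card S < r * num_components (del_verts (del_edge G e) S)"
        using q(3) pos by (metis mult_less_cancel_right_pos)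
    next
      assume "\<exists>S. separator (del_edge G e) S \<and>
          card S < r * num_components (del_verts (del_edge G e) S)"
      then obtain S where "separator (del_edge G e) S"
        "card S < r * num_components (del_verts (del_edge G e) S)" by blast
      then have "q < r" using q(2) pos by (metis mult_less_cancel_right_pos le_less_trans)
      then show "toughness (del_edge G e) < ereal r" using q(1) by simp
    qed
  qed (auto simp: toughness_def)
  show ?thesis
  proof
    assume "minimally_tough G"
    then have "\<forall>e\<in>edges G. toughness (del_edge G e) < ereal t"
      using t(1) by (auto simp: minimally_tough_def minimally_t_tough_def)
    then show "\<exists>t. ?tough t \<and> ?fragile t" using t(2) less by blast
  next
    assume "\<exists>t. ?tough t \<and> ?fragile t"
    then obtain r where r: "?tough r" "?fragile r" by blast
    obtain S where S: "separator G S" "t * num_components (del_verts G S) = card S"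
      using attained by blast
    then have "r * num_components (del_verts G S) \<le> t * num_components (del_verts G S)"
      using r(1) by metis
    moreover have "real (num_components (del_verts G S)) > 0"
      using S(1) by (simp add: separator_def)
    ultimately have "ereal r \<le> ereal t" by simp
    then have "\<forall>e\<in>edges G. toughness (del_edge G e) < ereal t"
      using r(2) less less_le_trans by blast
    then show "minimally_tough G"
      using t(1) by (auto simp: minimally_tough_def minimally_t_tough_def)
  qed
qed

section \<open>The local structure of a minimally tough cograph\<close>

text \<open>
  The vertices are automatically distinct: the six adjacency conditions rule out any coincidence.
\<close>
lemma P4_freeD:
  assumes "simple_graph G" "P4_free G"
    and "adjacent G a b" "adjacent G b c" "adjacent G c d"
    and "\<not> adjacent G a c" "\<not> adjacent G b d" "\<not> adjacent G a d"
  shows False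
proof -
  have V: "{a, b, c, d} \<subseteq> verts G"
    using adjacent_verts[OF assms(1)] assms(3-5) by auto
  have distinct: "a \<noteq> b" "a \<noteq> c" "a \<noteq> d" "b \<noteq> c" "b \<noteq> d" "c \<noteq> d"
    using assms not_adjacent_self[OF assms(1)] adjacent_sym[of G] by metis+
  have no: "\<not> adjacent G a a" "\<not> adjacent G b b" "\<not> adjacent G c c" "\<not> adjacent G d d"
    using not_adjacent_self[OF assms(1)] by auto
  define f :: "'a \<Rightarrow> nat" where "f = (\<lambda>_. 0)(b := 1, c := 2, d := 3)"
  have f: "f a = 0" "f b = 1" "f c = 2" "f d = 3"
    using distinct by (auto simp: f_def)
  let ?H = "induced G {a, b, c, d}"
  have adj: "adjacent ?H u v \<longleftrightarrow> adjacent G u v" if "u \<in> {a, b, c, d}" "v \<in> {a, b, c, d}" for u v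
    using that by (auto simp: adjacent_def induced_def)
  have sym: "adjacent G b a" "adjacent G c b" "adjacent G d c"
    "\<not> adjacent G c a" "\<not> adjacent G d b" "\<not> adjacent G d a"
    using assms adjacent_sym[of G] by blast+
  have "adjacent ?H u v \<longleftrightarrow> adjacent P4 (f u) (f v)"
    if "u \<in> {a, b, c, d}" "v \<in> {a, b, c, d}" for u v
    unfolding adj[OF that] using that assms(3-8) no sym f
    by (auto simp: adjacent_def P4_def doubleton_eq_iff)
  moreover have "bij_betw f {a, b, c, d} {0, 1, 2, 3}"
    using distinct f by (auto simp: bij_betw_def inj_on_def)
  ultimately have "?H \<cong>\<^sub>g P4"
    unfolding graph_iso_def by (intro exI[of _ f]) (auto simp: induced_def P4_def)
  then show False using assms(2) V unfolding P4_free_def by blast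
qed

lemma isolated_unreachable:
  assumes "\<And>w. \<not> adjacent G x w" "x \<noteq> y"
  shows "\<not> reachable G x y"
  using assms by (metis converse_rtranclpE)

lemma path_crossing:
  assumes "reachable G x y" "\<not> Q x" "Q y"
  obtains p q where "reachable G x p" "adjacent G p q" "\<not> Q p" "Q q"
  using assms by (induction arbitrary: thesis rule: rtranclp_induct) blast+

lemma reachable_del_verts:
  assumes "reachable (del_verts G S) x y" "x \<in> verts G - S"
  shows "y \<in> verts G - S"
  using assms by (induction rule: rtranclp_induct) (auto simp: adjacent_del_verts)

lemma small_join_sizes:
  fixes s m :: nat
  assumes "s * m < 2 * s + m" "s \<ge> 1" "m \<ge> 2"
  shows "s = 1 \<or> s = 2 \<and> m = 3 \<or> m = 2"
proof (rule ccontr)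
  assume neg: "\<not> ?thesis"
  then obtain i j where ij: "s = 2 + i" "m = 3 + j"
    using assms(2,3) le_Suc_ex[of 2 s] le_Suc_ex[of 3 m] by auto
  show False using assms(1) neg unfolding ij by (simp add: algebra_simps)
qed

text \<open>
  A walk that avoids \<open>S - {s}\<close> but cannot be completed without \<open>s\<close> has to leave the component of its
  first vertex through a neighbour of \<open>s\<close>.
\<close>
lemma reachable_boundary:
  assumes "reachable (del_verts G (S - {s})) u v" "u \<in> verts G - S"
  shows "reachable (del_verts G S) u v \<or> (\<exists>p. reachable (del_verts G S) u p \<and> adjacent G p s)"
  using assms(1)
proof (induction rule: rtranclp_induct)
  case (step y z)
  show ?case
  proof (cases "reachable (del_verts G S) u y \<and> z \<noteq> s")
    case True
    then have "y \<in> verts G - S" using reachable_del_verts[OF _ assms(2)] by blast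
    then have "adjacent (del_verts G S) y z" using step.hyps(2) True by (simp add: adjacent_del_verts)
    then show ?thesis using True by (meson rtranclp.rtrancl_into_rtrancl)
  next
    case False
    then have "reachable (del_verts G S) u y \<and> z = s \<or>
        (\<exists>p. reachable (del_verts G S) u p \<and> adjacent G p s)"
      using step.IH by blast
    moreover have "adjacent G y z" using step.hyps(2) by (simp add: adjacent_del_verts)
    ultimately show ?thesis by blast
  qed
qed auto

text \<open>
  The number \<open>t\<close> plays the role of the toughness, described by the inequalities of
  \<open>noncomplete_minimally_tough_iff\<close>.
\<close>
locale minimally_tough_cograph =
  fixes G :: "'a ugraph" and t :: real
  assumes simple: "simple_graph G"
    and no_P4: "\<And>a b c d. adjacent G a b \<Longrightarrow> adjacent G b c \<Longrightarrow> adjacent G c d \<Longrightarrow>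
      \<not> adjacent G a c \<Longrightarrow> \<not> adjacent G b d \<Longrightarrow> \<not> adjacent G a d \<Longrightarrow> False"
    and noncomplete: "\<not> complete_graph G"
    and has_edge: "\<not> edgeless G"
    and tough: "\<And>S. separator G S \<Longrightarrow> t * num_components (del_verts G S) \<le> card S"
    and fragile: "\<And>e. e \<in> edges G \<Longrightarrow> \<exists>S. separator (del_edge G e) S \<and>
      card S < t * num_components (del_verts (del_edge G e) S)"
begin

definition low :: "'a \<Rightarrow> bool" where
  "low v \<longleftrightarrow> card (neighbors G v) < 2 * t + 1"

lemma finite_verts: "finite (verts G)"
  using simple by (simp add: simple_graph_def)

lemma t_pos: "t > 0"
proof -
  obtain e where "e \<in> edges G" using has_edge by (auto simp: edgeless_def)
  then obtain S where "card S < t * num_components (del_verts (del_edge G e) S)"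
    using fragile by blast
  then have "0 < t * num_components (del_verts (del_edge G e) S)" by linarith
  then show ?thesis by (simp add: zero_less_mult_iff)
qed

lemma separator_bound: "separator G S \<Longrightarrow> 2 * t \<le> card S"
proof -
  assume S: "separator G S"
  then have "t * 2 \<le> t * num_components (del_verts G S)"
    using t_pos by (intro mult_left_mono) (auto simp: separator_def)
  then show ?thesis using tough[OF S] by linarith
qed

text \<open>
  Removing all but two non-adjacent vertices leaves two components.
\<close>
lemma twice_toughness: "2 * t \<le> real (card (verts G)) - 2"
proof -
  obtain x y where xy: "x \<in> verts G" "y \<in> verts G" "x \<noteq> y" "\<not> adjacent G x y"
    using noncomplete by (auto simp: complete_graph_def)
  then have "2 * t \<le> card (verts G - {x, y})"
    using separator_bound separator_of_nonadjacent(1)[OF simple] by blast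
  moreover have "card (verts G - {x, y}) = card (verts G) - 2"
    using xy by (simp add: card_Diff_subset)
  moreover have "card (verts G) \<ge> 2"
    using xy finite_verts by (metis card_2_iff card_mono empty_subsetI insert_subset)
  ultimately show ?thesis by simp
qed

text \<open>
  A vertex adjacent to all others has degree \<open>n - 1\<close>, which is at least \<open>2t + 1\<close> by
  \<open>twice_toughness\<close>.
\<close>
lemma low_nondominating:
  assumes "low v" "v \<in> verts G"
  obtains w where "w \<in> verts G" "w \<noteq> v" "\<not> adjacent G v w"
proof (rule ccontr)
  assume "\<not> thesis"
  then have "neighbors G v = verts G - {v}"
    using that not_adjacent_self[OF simple] by (auto simp: neighbors_def)
  then have "real (card (neighbors G v)) = real (card (verts G)) - 1"
    using assms(2) finite_verts by (simp add: card_Diff_singleton card_gt_0_iff of_nat_diff Suc_leI)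
      (metis One_nat_def Suc_leI card_gt_0_iff empty_iff of_nat_1 of_nat_diff)
  then show False using assms(1) twice_toughness by (simp add: low_def)
qed

text \<open>
  The neighbourhood of \<open>v\<close> separates \<open>v\<close> from \<open>w\<close>.
\<close>
lemma nondominating_degree:
  assumes "v \<in> verts G" "w \<in> verts G" "v \<noteq> w" "\<not> adjacent G v w"
  shows "2 * t \<le> card (neighbors G v)"
proof (rule separator_bound)
  let ?H = "del_verts G (neighbors G v)"
  have "\<not> adjacent ?H v x" for x by (auto simp: neighbors_def adjacent_del_verts)
  then have "\<not> reachable ?H v w" by (rule isolated_unreachable) fact
  moreover have "v \<in> verts ?H" "w \<in> verts ?H"
    using assms not_adjacent_self[OF simple] by (auto simp: neighbors_def)
  ultimately show "separator G (neighbors G v)"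
    unfolding separator_def using two_components_iff[OF simple_del_verts[OF simple]]
    by (auto simp: neighbors_def)
qed

text \<open>
  This is the only place where the effect of deleting an edge is used. The witness \<open>T\<close> for
  the drop in toughness contains neither \<open>u\<close> nor \<open>v\<close> and leaves exactly two components, one
  around each end of the deleted edge. If both ends kept another neighbour outside \<open>T\<close>, these neighbours
  \<open>a\<close> and \<open>b\<close> would form the induced path \<open>a, u, v, b\<close>.
\<close>
lemma dominating_edge_has_low_end:
  assumes uv: "adjacent G u v"
    and dom: "\<And>w. w \<in> verts G \<Longrightarrow> w \<noteq> u \<Longrightarrow> w \<noteq> v \<Longrightarrow> adjacent G w u \<or> adjacent G w v"
  shows "low u \<or> low v"
proof -
  obtain T where T: "separator (del_edge G {u, v}) T"
    "card T < t * num_components (del_verts (del_edge G {u, v}) T)"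
    using fragile uv unfolding adjacent_def by blast
  define H where "H = del_verts (del_edge G {u, v}) T"
  have simpleH: "simple_graph H"
    unfolding H_def by (intro simple_del_verts simple_del_edge simple)
  have TV: "T \<subseteq> verts G" and two: "num_components H \<ge> 2"
    using T(1) by (auto simp: separator_def H_def)
  \<comment> \<open>Otherwise \<open>T\<close> would be a separator of \<open>G\<close> that violates toughness.\<close>
  have "\<not> del_verts (del_edge G {u, v}) T = del_verts G T"
  proof
    assume eq: "del_verts (del_edge G {u, v}) T = del_verts G T"
    then have "separator G T" using T(1) by (simp add: separator_def)
    then show False using tough T(2) eq by fastforce
  qed
  then have uT: "u \<notin> T" and vT: "v \<notin> T"
    using del_edge_del_verts[of u T G v] del_edge_del_verts[of v T G u] by (auto simp: insert_commute)
  have uvG: "u \<in> verts G" "v \<in> verts G" using adjacent_verts[OF simple uv] by auto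
  have adjH: "adjacent H x y \<longleftrightarrow> adjacent G x y \<and> {x, y} \<noteq> {u, v} \<and> x \<in> verts G - T \<and> y \<in> verts G - T"
    for x y by (auto simp: H_def adjacent_del_verts adjacent_del_edge)
  have vertsH: "verts H = verts G - T" by (simp add: H_def)
  have reach: "reachable H w u \<or> reachable H w v" if "w \<in> verts H" for w
  proof (cases "w = u \<or> w = v")
    case False
    then have "adjacent H w u \<or> adjacent H w v"
      using dom[of w] that uvG uT vT by (auto simp: adjH vertsH doubleton_eq_iff)
    then show ?thesis by blast
  qed auto
  \<comment> \<open>If \<open>u\<close> still reached \<open>v\<close>, domination would make \<open>H\<close> connected.\<close>
  have sep: "\<not> reachable H u v"
  proof
    assume "reachable H u v"
    then have "reachable H w u" if "w \<in> verts H" for w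
      using reach[OF that] reachable_sym[of H u v] by (metis rtranclp_trans)
    then show False
      using two two_components_iff[OF simpleH] by (metis reachable_sym rtranclp_trans)
  qed
  have "num_components H \<le> 2"
    by (rule at_most_two_components[OF reach]) (use uvG uT vT in \<open>auto simp: vertsH\<close>)
  then have "num_components H = 2" using two by simp
  then have cardT: "card T < 2 * t" using T(2) by (simp add: H_def mult.commute)
  have finT: "finite T" using TV finite_verts finite_subset by blast
  have count: "card (neighbors G x) < 2 * t + 1" if "neighbors G x - {y} \<subseteq> T" for x y
  proof -
    have "neighbors G x \<subseteq> insert y T" using that by auto
    then have "card (neighbors G x) \<le> card (insert y T)" using finT by (intro card_mono) auto
    also have "\<dots> \<le> card T + 1" using finT by (simp add: card_insert_if)
    finally show ?thesis using cardT by linarith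
  qed
  have "neighbors G u - {v} \<subseteq> T \<or> neighbors G v - {u} \<subseteq> T"
  proof (rule ccontr)
    assume "\<not> ?thesis"
    then obtain a b where a: "adjacent G u a" "a \<in> verts G - T" "a \<noteq> v"
      and b: "adjacent G v b" "b \<in> verts G - T" "b \<noteq> u"
      by (auto simp: neighbors_def)
    have ne: "a \<noteq> u" "b \<noteq> v" using a b not_adjacent_self[OF simple] by auto
    have ua: "adjacent H u a" and bv: "adjacent H b v"
      using a b ne uvG uT vT by (auto simp: adjH doubleton_eq_iff adjacent_sym)
    have "\<not> adjacent H a v" "\<not> adjacent H u b" "\<not> adjacent H a b"
      using sep ua bv by (meson converse_rtranclp_into_rtranclp rtranclp.rtrancl_refl)+
    then have "\<not> adjacent G a v" "\<not> adjacent G u b" "\<not> adjacent G a b"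
      using a b ne uvG uT vT by (auto simp: adjH doubleton_eq_iff)
    then show False using no_P4[of a u v b] a(1) b(1) uv by (simp add: adjacent_sym)
  qed
  then show ?thesis unfolding low_def using count by blast
qed

text \<open>
  Take \<open>S\<close> as small as possible among the separators avoiding \<open>x\<close> and \<open>y\<close>. By minimality every
  \<open>s \<in> S\<close> has a neighbour in every component of \<open>G - S\<close>. Suppose that \<open>s\<close> misses a vertex of
  some component. Along a path inside that component there are adjacent \<open>a, b\<close> with \<open>s\<close> adjacent
  to \<open>b\<close> only, and with a neighbour \<open>d\<close> of \<open>s\<close> in another component \<open>a, b, s, d\<close> is an induced
  path.
\<close>
lemma join_separator:
  assumes "x \<in> verts G" "y \<in> verts G" "x \<noteq> y" "\<not> adjacent G x y"
  obtains S where "separator G S" "x \<notin> S" "y \<notin> S"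
    "\<And>s w. s \<in> S \<Longrightarrow> w \<in> verts G - S \<Longrightarrow> adjacent G s w"
proof -
  let ?P = "\<lambda>S. separator G S \<and> x \<notin> S \<and> y \<notin> S"
  have "?P (verts G - {x, y})"
    using separator_of_nonadjacent(1)[OF simple assms] by simp
  then obtain S where S: "?P S" and least: "\<And>S'. ?P S' \<Longrightarrow> card S \<le> card S'"
    using ex_has_least_nat[of ?P _ card] by blast
  have finS: "finite S" using S finite_verts by (auto simp: separator_def intro: finite_subset)
  define H where "H = del_verts G S"
  have adjH: "adjacent H p q \<longleftrightarrow> adjacent G p q \<and> p \<in> verts G - S \<and> q \<in> verts G - S" for p q
    by (simp add: H_def adjacent_del_verts)
  have "adjacent G s w" if s: "s \<in> S" and w: "w \<in> verts G - S" for s w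
  proof (rule ccontr)
    assume nsw: "\<not> adjacent G s w"
    let ?K = "del_verts G (S - {s})"
    have "\<not> ?P (S - {s})"
      using least[of "S - {s}"] s finS by (metis card_Diff1_less leD)
    then have "\<not> num_components ?K \<ge> 2" using S by (auto simp: separator_def)
    then have K: "reachable ?K p q" if "p \<in> verts G - S" "q \<in> verts G - S" for p q
      using that two_components_iff[OF simple_del_verts[OF simple]] by auto
    have "num_components H \<ge> 2" using S by (simp add: separator_def H_def)
    then obtain p q where "p \<in> verts G - S" "q \<in> verts G - S" "\<not> reachable H p q"
      using two_components_iff[OF simple_del_verts[OF simple]] unfolding H_def by auto
    then obtain w' where w': "w' \<in> verts G - S" "\<not> reachable H w w'"
      by (metis reachable_sym rtranclp_trans)
    have attach: "\<exists>p. reachable H u p \<and> adjacent G p s"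
      if u: "u \<in> verts G - S" and v: "v \<in> verts G - S" "\<not> reachable H u v" for u v
      using reachable_boundary[OF K[OF u v(1)] u] v(2) by (simp add: H_def)
    obtain z where z: "reachable H w z" "adjacent G z s" using attach[OF w w'] by metis
    obtain d where d: "reachable H w' d" "adjacent G d s"
      using attach[OF w'(1) w] w'(2) reachable_sym[of H w' w] by metis
    have dS: "d \<in> verts G - S"
      using reachable_del_verts[of G S w' d] d(1) w'(1) by (simp add: H_def)
    obtain a b where ab: "reachable H w a" "adjacent H a b" "\<not> adjacent G a s" "adjacent G b s"
      using path_crossing[OF z(1), of "\<lambda>q. adjacent G q s"] nsw z(2) adjacent_sym[of G s w] by metis
    have apart: "\<not> adjacent H c d" if "reachable H w c" for c
    proof
      assume "adjacent H c d"
      then have "reachable H w d" using that by simp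
      then show False using d(1) w'(2) by (meson reachable_sym rtranclp_trans)
    qed
    have "reachable H w b" using ab by simp
    then have "\<not> adjacent H a d" "\<not> adjacent H b d" using apart ab(1) by blast+
    then have "\<not> adjacent G a d" "\<not> adjacent G b d" using ab(2) dS by (auto simp: adjH)
    then show False using no_P4[of a b s d] ab d(2) by (auto simp: adjH adjacent_sym)
  qed
  then show ?thesis using that S by blast
qed

text \<open>
  Every edge between the two sides of a join dominates, so one of the sides consists of low vertices only.
  If it is the separator \<open>S\<close>, then \<open>S\<close> contains two non-adjacent vertices \<open>a, b\<close>, since low
  vertices are not dominating. A second separator \<open>R\<close> avoiding \<open>a\<close> and \<open>b\<close> has to contain everything outside \<open>S\<close>,
  as a single remaining vertex there would connect what is left.
\<close>
lemma low_side:
  obtains S where "separator G S"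
    "\<And>s w. s \<in> S \<Longrightarrow> w \<in> verts G - S \<Longrightarrow> adjacent G s w"
    "\<And>w. w \<in> verts G - S \<Longrightarrow> low w"
proof -
  obtain x y where xy: "x \<in> verts G" "y \<in> verts G" "x \<noteq> y" "\<not> adjacent G x y"
    using noncomplete by (auto simp: complete_graph_def)
  obtain S where S: "separator G S" "\<And>s w. s \<in> S \<Longrightarrow> w \<in> verts G - S \<Longrightarrow> adjacent G s w"
    using join_separator[OF xy] by metis
  have SV: "S \<subseteq> verts G" using S(1) by (simp add: separator_def)
  show ?thesis
  proof (cases "\<forall>w\<in>verts G - S. low w")
    case True
    then show ?thesis using that S by blast
  next
    case False
    then obtain v where v: "v \<in> verts G - S" "\<not> low v" by blast
    have lowS: "low s" if "s \<in> S" for s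
    proof -
      have "adjacent G w s \<or> adjacent G w v" if "w \<in> verts G" for w
        using S(2)[of s w] S(2)[of w v] \<open>s \<in> S\<close> v that by (auto simp: adjacent_sym)
      then show ?thesis
        using dominating_edge_has_low_end[OF S(2)[OF that v(1)]] v(2) by blast
    qed
    have "S \<noteq> {}" using separator_bound[OF S(1)] t_pos by auto
    then obtain a where a: "a \<in> S" by blast
    then obtain b where b: "b \<in> verts G" "b \<noteq> a" "\<not> adjacent G a b"
      using low_nondominating[OF lowS] SV by blast
    then have "b \<in> S" using S(2)[OF a] by blast
    obtain R where R: "separator G R" "a \<notin> R" "b \<notin> R"
      "\<And>s w. s \<in> R \<Longrightarrow> w \<in> verts G - R \<Longrightarrow> adjacent G s w"
      using join_separator[of a b] a b SV by (metis subsetD)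
    have "verts G - R \<subseteq> S"
    proof (rule ccontr)
      assume "\<not> ?thesis"
      then obtain z where z: "z \<in> verts G - R" "z \<notin> S" by blast
      let ?H = "del_verts G R"
      have az: "adjacent ?H z a"
        using S(2)[OF a, of z] z R(2) SV a by (auto simp: adjacent_sym adjacent_del_verts)
      have "reachable ?H w z" if w: "w \<in> verts G - R" for w
      proof (cases "w \<in> S")
        case True
        then have "adjacent ?H w z" using S(2)[of w z] w z by (simp add: adjacent_del_verts)
        then show ?thesis by blast
      next
        case False
        then have "adjacent ?H w a" using S(2)[OF a, of w] w R(2) SV a by (auto simp: adjacent_sym adjacent_del_verts)
        then show ?thesis using az by (meson adjacent_sym r_into_rtranclp rtranclp.rtrancl_into_rtrancl)
      qed
      then have "\<not> num_components ?H \<ge> 2"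
        using two_components_iff[OF simple_del_verts[OF simple]]
        by (metis reachable_sym rtranclp_trans verts_del_verts)
      then show False using R(1) by (simp add: separator_def)
    qed
    then show ?thesis using that R(1,4) lowS by blast
  qed
qed

text \<open>
  Writing \<open>s = |S|\<close> and \<open>m = |W|\<close> for the low side \<open>W\<close>: a low vertex of \<open>W\<close> is adjacent to all of
  \<open>S\<close>, and \<open>s \<ge> 2t\<close>, which leaves no room for a neighbour in \<open>W\<close>. Hence \<open>G - S\<close> has \<open>m\<close>
  components, and \<open>s < 2t + 1\<close> together with \<open>t m \<le> s\<close> bounds both numbers.
\<close>
lemma independent_side:
  "\<exists>S\<subseteq>verts G. (\<forall>s\<in>S. \<forall>w\<in>verts G - S. adjacent G s w) \<and>
     (\<forall>v\<in>verts G - S. \<forall>w\<in>verts G - S. \<not> adjacent G v w) \<and> card S < 2 * t + 1 \<and>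
     (card S = 1 \<and> card (verts G - S) \<ge> 2 \<or> card S = 2 \<and> card (verts G - S) = 3 \<or>
      card S \<ge> 1 \<and> card (verts G - S) = 2)"
proof -
  obtain S where S: "separator G S"
    "\<And>s w. s \<in> S \<Longrightarrow> w \<in> verts G - S \<Longrightarrow> adjacent G s w"
    "\<And>w. w \<in> verts G - S \<Longrightarrow> low w" using low_side by metis
  have SV: "S \<subseteq> verts G" using S(1) by (simp add: separator_def)
  have finS: "finite S" using SV finite_verts finite_subset by blast
  have sub: "S \<subseteq> neighbors G v" if "v \<in> verts G - S" for v
    using S(2)[OF _ that] SV by (auto simp: neighbors_def adjacent_sym)
  have indep: "\<not> adjacent G v w" if "v \<in> verts G - S" "w \<in> verts G - S" for v w
  proof
    assume "adjacent G v w"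
    then have "insert w S \<subseteq> neighbors G v" using sub that by (auto simp: neighbors_def)
    then have "card (insert w S) \<le> card (neighbors G v)"
      using finite_neighbors[OF simple] by (intro card_mono)
    then have "card S + 1 \<le> card (neighbors G v)" using that finS by simp
    then have "card S < 2 * t" using S(3)[OF that(1)] unfolding low_def by linarith
    then show False using separator_bound[OF S(1)] by linarith
  qed
  let ?s = "card S" and ?m = "card (verts G - S)"
  have m: "num_components (del_verts G S) = ?m"
    by (subst num_components_edgeless) (use indep in \<open>auto simp: adjacent_del_verts\<close>)
  then have "?m \<ge> 2" using S(1) by (simp add: separator_def)
  then have "verts G - S \<noteq> {}" by (metis card.empty not_numeral_le_zero)
  then obtain v where v: "v \<in> verts G - S" by blast
  have "card S \<le> card (neighbors G v)"
    using sub[OF v] finite_neighbors[OF simple] by (intro card_mono)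
  then have s: "?s < 2 * t + 1" using S(3)[OF v] unfolding low_def by linarith
  have "real ?s * ?m < (2 * t + 1) * ?m"
    using s \<open>?m \<ge> 2\<close> by (intro mult_strict_right_mono) auto
  also have "\<dots> \<le> 2 * ?s + ?m"
    using tough[OF S(1)] by (simp add: m algebra_simps)
  finally have "real (?s * ?m) < real (2 * ?s + ?m)" by simp
  then have ineq: "?s * ?m < 2 * ?s + ?m" by linarith
  have "?s \<ge> 1" using separator_bound[OF S(1)] t_pos by linarith
  have sizes: "?s = 1 \<and> ?m \<ge> 2 \<or> ?s = 2 \<and> ?m = 3 \<or> ?s \<ge> 1 \<and> ?m = 2"
    using small_join_sizes[OF ineq] \<open>?s \<ge> 1\<close> \<open>?m \<ge> 2\<close> by linarith
  show ?thesis using SV S(2) indep s sizes by (intro exI[of _ S] conjI ballI)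
qed

end

section \<open>Complete multipartite graphs up to isomorphism\<close>

definition has_parts :: "'a ugraph \<Rightarrow> 'a set set \<Rightarrow> bool" where
  "has_parts G P \<longleftrightarrow> partition_on (verts G) P \<and>
     (\<forall>u\<in>verts G. \<forall>v\<in>verts G. adjacent G u v \<longleftrightarrow> (\<forall>A\<in>P. u \<in> A \<longrightarrow> v \<notin> A))"

definition part_sizes :: "'a set set \<Rightarrow> nat multiset" where
  "part_sizes P = image_mset card (mset_set P)"

lemma part_unique:
  assumes "partition_on V P" "A \<in> P" "B \<in> P" "x \<in> A" "x \<in> B"
  shows "A = B"
  using assms by (auto simp: partition_on_def pairwise_def disjnt_def)

text \<open>
  Two finite families with the same multiset of values can be matched so that
  values are preserved; this is applied to parts and their sizes.
\<close>
lemma bij_betw_same_image_mset: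
  assumes "finite A" "finite B" "image_mset f (mset_set A) = image_mset g (mset_set B)"
  shows "\<exists>h. bij_betw h A B \<and> (\<forall>x\<in>A. g (h x) = f x)"
  using assms
proof (induction A arbitrary: B rule: finite_induct)
  case empty
  then have "B = {}" by (simp add: mset_set_empty_iff)
  then show ?case by (simp add: bij_betw_def)
next
  case (insert x A)
  then have "f x \<in># image_mset g (mset_set B)"
    by (metis image_mset_add_mset mset_set.insert union_single_eq_member)
  then obtain y where y: "y \<in> B" "g y = f x" using insert.prems(1) by auto
  have "image_mset f (mset_set A) = image_mset g (mset_set (B - {y}))"
    using insert.prems insert.hyps y by (simp add: mset_set.remove)
  then obtain h where h: "bij_betw h A (B - {y})" "\<forall>z\<in>A. g (h z) = f z"
    using insert.IH[of "B - {y}"] insert.prems(1) by auto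
  have "bij_betw (h(x := y)) A (B - {y})"
    using h(1) insert.hyps(2) by (subst bij_betw_cong[of A _ h]) auto
  then have "bij_betw (h(x := y)) (A \<union> {x}) ((B - {y}) \<union> {y})"
    by (rule bij_betw_combine) auto
  then have "bij_betw (h(x := y)) (insert x A) B"
    using y(1) by (simp add: insert_absorb)
  then show ?case
    using h(2) y(2) insert.hyps(2)
    by (intro exI[of _ "h(x := y)"] conjI) (assumption, auto)
qed

lemma adjacent_complete_multipartite:
  assumes "partition_on V Q" "u \<in> V" "v \<in> V"
  shows "adjacent (complete_multipartite Q) u v \<longleftrightarrow> (\<forall>A\<in>Q. u \<in> A \<longrightarrow> v \<notin> A)"
proof
  assume "adjacent (complete_multipartite Q) u v"
  then obtain a b A B where "{u, v} = {a, b}" "A \<in> Q" "B \<in> Q" "A \<noteq> B" "a \<in> A" "b \<in> B"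
    unfolding adjacent_def complete_multipartite_def by auto
  then show "\<forall>A\<in>Q. u \<in> A \<longrightarrow> v \<notin> A"
    using part_unique[OF assms(1)] by (metis doubleton_eq_iff)
next
  assume sep: "\<forall>A\<in>Q. u \<in> A \<longrightarrow> v \<notin> A"
  obtain A B where "A \<in> Q" "B \<in> Q" "u \<in> A" "v \<in> B"
    using assms by (auto simp: partition_on_def)
  moreover from this have "A \<noteq> B" using sep by auto
  ultimately show "adjacent (complete_multipartite Q) u v"
    unfolding adjacent_def complete_multipartite_def by auto
qed

text \<open>
  A complete multipartite graph is determined up to isomorphism by the multiset of its part sizes.
  An isomorphism pulls the parts back; in the other direction, parts are matched with parts of the
  same size and the chosen bijections between them are glued.
\<close>
lemma iso_complete_multipartite_iff:
  fixes G :: "'a ugraph" and Q :: "'b set set"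
  assumes G: "simple_graph G" and V: "finite V" and Q: "partition_on V Q"
  shows "G \<cong>\<^sub>g complete_multipartite Q \<longleftrightarrow> (\<exists>P. has_parts G P \<and> part_sizes P = part_sizes Q)"
proof
  have vertsQ: "verts (complete_multipartite Q) = V"
    using partition_onD1[OF Q] by (simp add: complete_multipartite_def)
  assume "G \<cong>\<^sub>g complete_multipartite Q"
  then obtain f where f: "bij_betw f (verts G) V"
    "\<And>u v. u \<in> verts G \<Longrightarrow> v \<in> verts G \<Longrightarrow>
      adjacent G u v \<longleftrightarrow> adjacent (complete_multipartite Q) (f u) (f v)"
    unfolding graph_iso_def vertsQ by blast
  define pre where "pre A = {x \<in> verts G. f x \<in> A}" for A
  have image_pre: "f ` pre A = A" if "A \<in> Q" for A
    using f(1) partition_onD1[OF Q] that by (auto simp: pre_def bij_betw_def image_iff)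
  have inj: "inj_on pre Q" using image_pre by (metis inj_onI)
  have card: "card (pre A) = card A" if "A \<in> Q" for A
  proof -
    have "inj_on f (pre A)"
      using f(1) by (auto simp: pre_def bij_betw_def inj_on_def)
    then show ?thesis using card_image image_pre[OF that] by metis
  qed
  have "partition_on (verts G) (pre ` Q)"
  proof (rule partition_onI)
    show "\<Union> (pre ` Q) = verts G"
      using f(1) partition_onD1[OF Q] by (auto simp: pre_def bij_betw_def)
    show "disjnt p q" if "p \<in> pre ` Q" "q \<in> pre ` Q" "p \<noteq> q" for p q
    proof -
      obtain A B where AB: "A \<in> Q" "B \<in> Q" "p = pre A" "q = pre B" "A \<noteq> B"
        using \<open>p \<in> pre ` Q\<close> \<open>q \<in> pre ` Q\<close> \<open>p \<noteq> q\<close> by blast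
      have "x \<notin> B" if "x \<in> A" for x
        using part_unique[OF Q AB(1,2) that] AB(5) by metis
      then show ?thesis unfolding AB(3,4) disjnt_def pre_def by blast
    qed
    show "{} \<notin> pre ` Q" using image_pre partition_onD3[OF Q] by force
  qed
  moreover have "adjacent G u v \<longleftrightarrow> (\<forall>A\<in>pre ` Q. u \<in> A \<longrightarrow> v \<notin> A)"
    if "u \<in> verts G" "v \<in> verts G" for u v
  proof -
    have "f u \<in> V" "f v \<in> V" using that f(1) by (auto simp: bij_betw_def)
    then show ?thesis
      using that f(2)[OF that] adjacent_complete_multipartite[OF Q] by (simp add: pre_def)
  qed
  moreover have "part_sizes (pre ` Q) = part_sizes Q"
  proof -
    have "part_sizes (pre ` Q) = image_mset (\<lambda>A. card (pre A)) (mset_set Q)"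
      unfolding part_sizes_def image_mset_mset_set[OF inj, symmetric]
      by (simp add: multiset.map_comp comp_def)
    also have "\<dots> = part_sizes Q"
      unfolding part_sizes_def using finite_elements[OF V Q] card by (intro image_mset_cong) simp
    finally show ?thesis .
  qed
  ultimately show "\<exists>P. has_parts G P \<and> part_sizes P = part_sizes Q"
    unfolding has_parts_def by (intro exI[of _ "pre ` Q"]) simp
next
  have vertsQ: "verts (complete_multipartite Q) = V"
    using partition_onD1[OF Q] by (simp add: complete_multipartite_def)
  assume "\<exists>P. has_parts G P \<and> part_sizes P = part_sizes Q"
  then obtain P where GP: "has_parts G P" and sizes: "part_sizes P = part_sizes Q" by blast
  then have P: "partition_on (verts G) P"
    and adj: "\<And>u v. u \<in> verts G \<Longrightarrow> v \<in> verts G \<Longrightarrow>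
      adjacent G u v \<longleftrightarrow> (\<forall>A\<in>P. u \<in> A \<longrightarrow> v \<notin> A)"
    for u v by (simp_all add: has_parts_def)
  have finV: "finite (verts G)" using G by (simp add: simple_graph_def)
  have "finite P" "finite Q"
    using finite_elements[OF finV P] finite_elements[OF V Q] .
  then obtain h where h: "bij_betw h P Q" "\<And>A. A \<in> P \<Longrightarrow> card (h A) = card A"
    using bij_betw_same_image_mset[of P Q card card] sizes by (auto simp: part_sizes_def)
  have "\<exists>g. bij_betw g A (h A)" if "A \<in> P" for A
  proof -
    have "h A \<in> Q" using h(1) that by (auto simp: bij_betw_def)
    then have "finite A" "finite (h A)"
      using that partition_onD1[OF P] partition_onD1[OF Q] finV V
      by (metis Union_upper finite_subset)+
    then show ?thesis using finite_same_card_bij h(2)[OF that] by metis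
  qed
  then obtain g where g: "\<And>A. A \<in> P \<Longrightarrow> bij_betw (g A) A (h A)" by metis
  \<comment> \<open>The glued bijection applies to each vertex the bijection belonging to its part.\<close>
  define part where "part x = (THE A. A \<in> P \<and> x \<in> A)" for x
  have part: "part x = A" if "A \<in> P" "x \<in> A" for x A
    unfolding part_def using that part_unique[OF P] by (intro the_equality) auto
  define f where "f x = g (part x) x" for x
  have fg: "bij_betw f A (h A)" if "A \<in> P" for A
    using g[OF that] by (rule bij_betw_cong[THEN iffD1, rotated]) (simp add: f_def part[OF that])
  have disj: "disjoint_family_on h P"
    unfolding disjoint_family_on_def
  proof (intro ballI impI)
    fix A B assume AB: "A \<in> P" "B \<in> P" "A \<noteq> B"
    then have "h A \<noteq> h B" "h A \<in> Q" "h B \<in> Q"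
      using h(1) by (auto simp: bij_betw_def inj_on_def)
    then show "h A \<inter> h B = {}" using disjointD[OF partition_onD2[OF Q]] by blast
  qed
  have "bij_betw f (\<Union>A\<in>P. A) (\<Union>A\<in>P. h A)"
    by (rule bij_betw_UNION_disjoint[OF disj fg])
  then have bij: "bij_betw f (verts G) V"
    using h(1) partition_onD1[OF P] partition_onD1[OF Q] by (simp add: bij_betw_def)
  have mem: "f x \<in> h A \<longleftrightarrow> x \<in> A" if "A \<in> P" "x \<in> verts G" for x A
  proof
    assume fx: "f x \<in> h A"
    obtain B where B: "B \<in> P" "x \<in> B" using partition_onD1[OF P] \<open>x \<in> verts G\<close> by auto
    then have "f x \<in> h B" using fg by (auto simp: bij_betw_def)
    moreover have "h A \<in> Q" "h B \<in> Q" using h(1) that(1) B(1) by (auto simp: bij_betw_def)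
    ultimately have "h A = h B" using part_unique[OF Q _ _ fx] by blast
    then show "x \<in> A" using h(1) that(1) B by (auto simp: bij_betw_def inj_on_def)
  qed (use fg[OF that(1)] in \<open>auto simp: bij_betw_def\<close>)
  have "adjacent G u v \<longleftrightarrow> adjacent (complete_multipartite Q) (f u) (f v)"
    if uv: "u \<in> verts G" "v \<in> verts G" for u v
  proof -
    have "f u \<in> V" "f v \<in> V" using uv bij by (auto simp: bij_betw_def)
    then have "adjacent (complete_multipartite Q) (f u) (f v) \<longleftrightarrow>
        (\<forall>A\<in>h ` P. f u \<in> A \<longrightarrow> f v \<notin> A)"
      using adjacent_complete_multipartite[OF Q] h(1) by (simp add: bij_betw_def)
    also have "\<dots> \<longleftrightarrow> adjacent G u v" using adj[OF uv] mem uv by simp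
    finally show ?thesis by simp
  qed
  then show "G \<cong>\<^sub>g complete_multipartite Q"
    unfolding graph_iso_def vertsQ using bij by blast
qed

lemma has_parts_of_join:
  assumes "S \<subseteq> verts G" "S \<noteq> {}" "verts G - S \<noteq> {}"
    and "\<And>s w. s \<in> S \<Longrightarrow> w \<in> verts G - S \<Longrightarrow> adjacent G s w"
    and "\<And>v w. v \<in> verts G - S \<Longrightarrow> w \<in> verts G - S \<Longrightarrow> \<not> adjacent G v w"
    and "\<And>v w. v \<in> S \<Longrightarrow> w \<in> S \<Longrightarrow> \<not> adjacent G v w"
  shows "has_parts G {S, verts G - S}" "part_sizes {S, verts G - S} = {#card S, card (verts G - S)#}"
proof -
  have "adjacent G u v \<longleftrightarrow> (u \<in> S \<longleftrightarrow> v \<notin> S)" if "u \<in> verts G" "v \<in> verts G" for u v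
    using assms(4-6) that adjacent_sym[of G u v] by (cases "u \<in> S"; cases "v \<in> S") auto
  moreover have "partition_on (verts G) {S, verts G - S}"
    using assms(1-3) by (intro partition_onI) (auto simp: disjnt_def)
  ultimately show "has_parts G {S, verts G - S}" unfolding has_parts_def by auto
  have "S \<noteq> verts G - S" using assms(2) by blast
  then show "part_sizes {S, verts G - S} = {#card S, card (verts G - S)#}"
    by (simp add: part_sizes_def)
qed

lemma iso_complete_bipartite_iff:
  assumes "simple_graph G" "m > 0" "n > 0"
  shows "G \<cong>\<^sub>g complete_bipartite m n \<longleftrightarrow> (\<exists>P. has_parts G P \<and> part_sizes P = {#m, n#})"
proof -
  have ne: "{0..<m} \<noteq> {m..<m + n}" using assms by (auto simp: set_eq_iff)
  have "partition_on {0..<m + n} {{0..<m}, {m..<m + n}}"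
    using assms by (intro partition_onI) (auto simp: disjnt_def)
  moreover have "part_sizes {{0..<m}, {m..<m + n}} = {#m, n#}"
    using ne by (simp add: part_sizes_def)
  ultimately show ?thesis
    unfolding complete_bipartite_def
    using iso_complete_multipartite_iff[OF assms(1) finite_atLeastLessThan] by metis
qed

lemma part_sizes_turan:
  assumes "1 \<le> k" "k \<le> n"
  shows "part_sizes (turan_part n k ` {0..<k}) =
    replicate_mset (n mod k) (Suc (n div k)) + replicate_mset (k - n mod k) (n div k)"
proof -
  have "inj_on (turan_part n k) {0..<k}"
    using turan_parts(2)[OF assms] by (simp add: eq_card_imp_inj_on)
  then have "part_sizes (turan_part n k ` {0..<k}) =
      image_mset (\<lambda>r. card (turan_part n k r)) (mset_set {0..<k})"
    unfolding part_sizes_def by (simp add: image_mset_mset_set[symmetric] multiset.map_comp comp_def)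
  also have "\<dots> = image_mset (\<lambda>r. n div k + (if r < n mod k then 1 else 0)) (mset_set {0..<k})"
    by (intro image_mset_cong) (simp add: card_turan_part)
  also have "mset_set {0..<k} = mset_set ({0..<n mod k} \<union> {n mod k..<k})"
    using mod_less_divisor[of k n] assms(1) by (simp add: ivl_disj_un_two(3))
  also have "\<dots> = mset_set {0..<n mod k} + mset_set {n mod k..<k}"
    by (intro mset_set_Union) auto
  also have "image_mset (\<lambda>r. n div k + (if r < n mod k then 1 else 0)) \<dots> =
      image_mset (\<lambda>r. Suc (n div k)) (mset_set {0..<n mod k}) +
      image_mset (\<lambda>r. n div k) (mset_set {n mod k..<k})"
    unfolding image_mset_union by (intro arg_cong2[of _ _ _ _ "(+)"] image_mset_cong) auto
  also have "\<dots> = replicate_mset (n mod k) (Suc (n div k)) + replicate_mset (k - n mod k) (n div k)"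
    by (simp add: image_mset_const_eq)
  finally show ?thesis .
qed

lemma iso_turan_iff:
  assumes "simple_graph G" "1 \<le> k" "k \<le> n"
  shows "G \<cong>\<^sub>g turan_graph n k \<longleftrightarrow> (\<exists>P. has_parts G P \<and> part_sizes P =
    replicate_mset (n mod k) (Suc (n div k)) + replicate_mset (k - n mod k) (n div k))"
  unfolding turan_graph_def part_sizes_turan[OF assms(2,3), symmetric]
  by (rule iso_complete_multipartite_iff[OF assms(1) _ turan_parts(1)[OF assms(2,3)]]) simp

section \<open>The listed graphs are minimally tough\<close>

lemma has_parts_adjacent:
  assumes "has_parts G P" "A \<in> P" "u \<in> A" "v \<in> verts G"
  shows "adjacent G u v \<longleftrightarrow> v \<notin> A"
proof -
  have P: "partition_on (verts G) P" using assms(1) by (simp add: has_parts_def)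
  have "u \<in> verts G" using partition_onD1[OF P] assms(2,3) by auto
  then show ?thesis
    using assms part_unique[OF P assms(2)] unfolding has_parts_def by blast
qed

lemma card_verts_parts:
  assumes "simple_graph G" "has_parts G P"
  shows "card (verts G) = sum_mset (part_sizes P)"
proof -
  have P: "partition_on (verts G) P" using assms(2) by (simp add: has_parts_def)
  have fin: "finite (verts G)" using assms(1) by (simp add: simple_graph_def)
  have "card (\<Union>P) = sum card P"
    using partition_onD2[OF P] fin partition_onD1[OF P]
    by (intro card_Union_disjoint) (auto intro: finite_subset)
  then show ?thesis
    using partition_onD1[OF P] by (simp add: part_sizes_def sum_unfold_sum_mset)
qed

text \<open>
  What a separator leaves lies inside one part \<open>A\<close>: the unconnected vertices \<open>x, y\<close> are in the same part,
  and a vertex from another part would connect them. So with \<open>c\<close> vertices left there are \<open>c \<le> a\<close>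
  components, and \<open>(n - c) / c\<close> is decreasing in \<open>c\<close>.
\<close>
lemma multipartite_separator_bound:
  assumes G: "simple_graph G" "has_parts G P"
    and small: "\<And>A. A \<in> P \<Longrightarrow> card A \<le> a" and "a > 0"
    and S: "separator G S"
  shows "(real (card (verts G)) - a) / a * num_components (del_verts G S) \<le> card S"
proof -
  let ?H = "del_verts G S"
  have P: "partition_on (verts G) P" using G(2) by (simp add: has_parts_def)
  have fin: "finite (verts G)" using G(1) by (simp add: simple_graph_def)
  have SV: "S \<subseteq> verts G" using S by (simp add: separator_def)
  obtain x y where xy: "x \<in> verts G - S" "y \<in> verts G - S" "\<not> reachable ?H x y"
    using S two_components_iff[OF simple_del_verts[OF G(1)]] unfolding separator_def by auto
  have nadj: "\<not> (adjacent ?H x z \<and> adjacent ?H z y)" "\<not> adjacent ?H x y" for z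
    using xy(3) by (meson r_into_rtranclp rtranclp.rtrancl_into_rtrancl)+
  obtain A where A: "A \<in> P" "x \<in> A" using xy(1) partition_onD1[OF P] by auto
  have "y \<in> A"
    using nadj(2) xy has_parts_adjacent[OF G(2) A] by (auto simp: adjacent_del_verts)
  have sub: "verts G - S \<subseteq> A"
  proof
    fix z assume z: "z \<in> verts G - S"
    show "z \<in> A"
      using nadj(1)[of z] xy(1,2) z has_parts_adjacent[OF G(2) A, of z]
        has_parts_adjacent[OF G(2) A(1) \<open>y \<in> A\<close>, of z]
      by (auto simp: adjacent_del_verts adjacent_sym[of G z y])
  qed
  have "num_components ?H = card (verts G - S)"
    by (subst num_components_edgeless)
       (use sub has_parts_adjacent[OF G(2) A(1)] in \<open>auto simp: adjacent_del_verts\<close>)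
  also have "\<dots> = card (verts G) - card S"
    using SV fin by (simp add: card_Diff_subset finite_subset)
  finally have s: "real (card S) = real (card (verts G)) - num_components ?H"
    using card_mono[OF fin SV] by simp
  have "finite A" using A(1) partition_onD1[OF P] fin by (auto intro: finite_subset)
  then have "num_components ?H \<le> a"
    using card_mono[OF _ sub] small[OF A(1)] \<open>num_components ?H = card (verts G - S)\<close> by fastforce
  then have "real (card (verts G)) * num_components ?H \<le> real (card (verts G)) * a"
    by (intro mult_left_mono) auto
  then have "(real (card (verts G)) - a) * num_components ?H \<le> real (card S) * a"
    unfolding s by (simp add: algebra_simps)
  then show ?thesis using \<open>a > 0\<close> by (simp add: field_simps)
qed

text \<open>
  Only one part may have a size different from \<open>a\<close>, so every edge has an end \<open>v\<close> in a
  part \<open>A\<close> of size \<open>a\<close>. After deletion of the edge \<open>uv\<close> the vertex \<open>v\<close> is isolated by the removal of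
  everything outside \<open>A \<union> {u}\<close>, and another vertex of \<open>A\<close> remains. The last hypothesis says that this beats the
  bound \<open>(n - a) / a\<close> of \<open>multipartite_separator_bound\<close>; it holds in the four families.
\<close>
lemma multipartite_minimally_tough:
  assumes G: "simple_graph G" "has_parts G P"
    and sizes: "part_sizes P = add_mset b (replicate_mset k a)"
    and "b \<le> a" "2 \<le> a" "1 \<le> k"
    and few: "real (b + k * a) - a - 1 < 2 * ((real (b + k * a) - a) / a)"
  shows "nontrivially_minimally_tough G"
proof -
  have P: "partition_on (verts G) P" using G(2) by (simp add: has_parts_def)
  have fin: "finite (verts G)" using G(1) by (simp add: simple_graph_def)
  have finP: "finite P" by (rule finite_elements[OF fin P])
  have n: "card (verts G) = b + k * a"
    using card_verts_parts[OF G] by (simp add: sizes)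
  have part_cards: "card ` P = {a, b}"
  proof -
    have "card ` P = set_mset (part_sizes P)" using finP by (simp add: part_sizes_def)
    then show ?thesis using sizes \<open>1 \<le> k\<close> by auto
  qed
  then have small: "card A \<le> a" if "A \<in> P" for A
    using that \<open>b \<le> a\<close> by auto
  have full: "card A = a \<or> card B = a" if "A \<in> P" "B \<in> P" "A \<noteq> B" for A B
  proof (rule ccontr)
    assume neg: "\<not> ?thesis"
    then have "card A = b" "card B = b" "b \<noteq> a" using part_cards that by auto
    \<comment> \<open>Both parts would have the exceptional size \<open>b\<close>, which occurs only once among the sizes.\<close>
    then have "{#b, b#} = image_mset card (mset_set {A, B})" using that by simp
    also have "\<dots> \<subseteq># part_sizes P"
      unfolding part_sizes_def using that finP
      by (intro image_mset_subseteq_mono subset_imp_msubset_mset_set) auto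
    finally have "count {#b, b#} b \<le> count (part_sizes P) b" by (rule mset_subset_eq_count)
    then show False using \<open>b \<noteq> a\<close> by (simp add: sizes)
  qed
  have ex_full: "\<exists>A\<in>P. card A = a" using part_cards by (metis image_iff insertI1)
  have noncomplete: "\<not> complete_graph G"
  proof -
    obtain A where A: "A \<in> P" "card A = a" using ex_full by blast
    then obtain u v where "u \<in> A" "v \<in> A" "u \<noteq> v"
      using \<open>2 \<le> a\<close> by (metis card_le_Suc0_iff_eq card.infinite not_numeral_le_zero not_less_eq_eq
        numeral_2_eq_2)
    then show ?thesis
      using has_parts_adjacent[OF G(2) A(1)] partition_onD1[OF P] A(1)
      unfolding complete_graph_def by blast
  qed
  moreover have "\<not> edgeless G"
  proof -
    have "size (part_sizes P) \<ge> 2" using sizes \<open>1 \<le> k\<close> by simp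
    then have "card P \<ge> 2" by (simp add: part_sizes_def)
    then obtain A B where AB: "A \<in> P" "B \<in> P" "A \<noteq> B"
      by (metis card_le_Suc0_iff_eq finP not_less_eq_eq numeral_2_eq_2)
    then obtain u v where "u \<in> A" "v \<in> B" using partition_onD3[OF P] by (metis ex_in_conv)
    then have "adjacent G u v"
      using has_parts_adjacent[OF G(2) AB(1), of u v] part_unique[OF P AB(1,2)] AB
        partition_onD1[OF P] by blast
    then show ?thesis by (auto simp: edgeless_def adjacent_def)
  qed
  moreover have "minimally_tough G"
    unfolding noncomplete_minimally_tough_iff[OF G(1) noncomplete]
  proof (intro exI[of _ "(real (card (verts G)) - a) / a"] conjI allI impI ballI)
    let ?t = "(real (card (verts G)) - a) / a"
    show "?t * num_components (del_verts G S) \<le> card S" if "separator G S" for S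
      using multipartite_separator_bound[OF G small _ that] \<open>2 \<le> a\<close> by simp
    fix e assume "e \<in> edges G"
    then obtain u' v' where e': "e = {u', v'}" "u' \<in> verts G" "v' \<in> verts G" "adjacent G u' v'"
      using edge_endpoints[OF G(1)] by metis
    obtain U' V' where parts: "U' \<in> P" "V' \<in> P" "u' \<in> U'" "v' \<in> V'"
      using e' partition_onD1[OF P] by auto
    then have "U' \<noteq> V'" using has_parts_adjacent[OF G(2), of U' u' v'] e' by auto
    then have "card U' = a \<or> card V' = a" using full parts by blast
    then obtain u v A where e: "e = {u, v}" "adjacent G u v" "u \<in> verts G"
      and A: "A \<in> P" "card A = a" "v \<in> A"
      using e' parts by (metis adjacent_sym insert_commute)
    have AV: "A \<subseteq> verts G" using A(1) partition_onD1[OF P] by auto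
    have finA: "finite A" using AV fin finite_subset by blast
    have uA: "u \<notin> A"
      using has_parts_adjacent[OF G(2) A(1,3) e(3)] e(2) by (simp add: adjacent_sym)
    define S where "S = verts G - insert u A"
    let ?H = "del_verts (del_edge G e) S"
    have vertsH: "verts ?H = insert u A" using AV e(3) by (auto simp: S_def)
    have "\<not> adjacent ?H v w" for w
      using has_parts_adjacent[OF G(2) A(1,3), of w]
      by (auto simp: adjacent_del_verts adjacent_del_edge S_def e(1) insert_commute)
    moreover obtain w where w: "w \<in> A" "w \<noteq> v"
      using \<open>2 \<le> a\<close> A(2,3) by (metis card_le_Suc0_iff_eq finA not_less_eq_eq numeral_2_eq_2)
    ultimately have "\<not> reachable ?H v w" by (intro isolated_unreachable) auto
    then have two: "num_components ?H \<ge> 2"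
      using two_components_iff[OF simple_del_verts[OF simple_del_edge[OF G(1)]]] vertsH w A(3)
      by blast
    then have sep: "separator (del_edge G e) S" by (auto simp: separator_def S_def)
    have "card S = card (verts G) - card (insert u A)"
      unfolding S_def using AV e(3) finA by (intro card_Diff_subset) auto
    moreover have "card (insert u A) \<le> card (verts G)"
      using AV e(3) fin by (intro card_mono) auto
    ultimately have "real (card S) = real (b + k * a) - a - 1"
      using uA finA A(2) n by simp
    also have "\<dots> < 2 * ?t" using few by (simp add: n)
    also have "\<dots> \<le> ?t * num_components ?H"
    proof -
      have "a \<le> k * a" using \<open>1 \<le> k\<close> by simp
      then have "a \<le> card (verts G)" using n by linarith
      then have "?t \<ge> 0" by simp
      then have "?t * 2 \<le> ?t * num_components ?H" using two by (intro mult_left_mono) auto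
      then show ?thesis by (simp add: mult.commute)
    qed
    finally show "\<exists>S. separator (del_edge G e) S \<and>
        real (card S) < ?t * num_components (del_verts (del_edge G e) S)"
      using sep by blast
  qed
  ultimately show ?thesis by (simp add: nontrivially_minimally_tough_def)
qed

section \<open>No other cograph is minimally tough\<close>

context minimally_tough_cograph
begin

text \<open>
  Two such vertices would span a dominating edge, one of whose ends is low and hence not dominating.
\<close>
lemma no_two_dominating:
  assumes "u \<in> verts G" "v \<in> verts G" "u \<noteq> v"
    and "\<And>w. w \<in> verts G \<Longrightarrow> w \<noteq> u \<Longrightarrow> adjacent G u w"
    and "\<And>w. w \<in> verts G \<Longrightarrow> w \<noteq> v \<Longrightarrow> adjacent G v w"
  shows False
proof -
  have "low u \<or> low v"
    using assms by (intro dominating_edge_has_low_end) (auto simp: adjacent_sym)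
  then show False using low_nondominating assms by metis
qed

text \<open>
  The degree condition says that every vertex misses at most one other vertex. The sets \<open>N v\<close> of
  vertices not adjacent to \<open>v\<close>, which include \<open>v\<close>, therefore have one or two elements and are the parts of a complete
  multipartite graph; by \<open>no_two_dominating\<close> at most one of them is a singleton.
\<close>
lemma parts_of_large_degrees:
  assumes large: "\<And>v. v \<in> verts G \<Longrightarrow> card (verts G) \<le> card (neighbors G v) + 2"
  obtains P l where "has_parts G P" "l \<ge> 2"
    "part_sizes P = replicate_mset l 2 \<or> part_sizes P = add_mset 1 (replicate_mset (l - 1) 2)"
proof -
  define N where "N v = verts G - neighbors G v" for v
  have N: "w \<in> N v \<longleftrightarrow> w \<in> verts G \<and> \<not> adjacent G v w" for v w
    by (auto simp: N_def neighbors_def)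
  have finN: "finite (N v)" for v using finite_verts by (simp add: N_def)
  have self: "v \<in> N v" if "v \<in> verts G" for v
    using that not_adjacent_self[OF simple] by (simp add: N)
  have card2: "card (N v) \<le> 2" if "v \<in> verts G" for v
  proof -
    have "card (N v) = card (verts G) - card (neighbors G v)"
      unfolding N_def using finite_neighbors[OF simple] by (intro card_Diff_subset) (auto simp: neighbors_def)
    then show ?thesis using large[OF that] by linarith
  qed
  have eq: "N w = N v" if "v \<in> verts G" "w \<in> N v" for v w
  proof (cases "w = v")
    case False
    have "w \<in> verts G" "v \<in> N w" using that by (auto simp: N adjacent_sym)
    have "X = {v, w}" if "v \<in> X" "w \<in> X" "card X \<le> 2" "finite X" for X
    proof -
      have "card {v, w} = 2" using False by simp
      then show ?thesis using that card_subset_eq[of X "{v, w}"] card_mono[of X "{v, w}"] by auto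
    qed
    then show ?thesis
      using that \<open>v \<in> N w\<close> self card2 finN \<open>w \<in> verts G\<close> by metis
  qed simp
  define P where "P = N ` verts G"
  have part: "partition_on (verts G) P"
  proof (rule partition_onI)
    show "\<Union> P = verts G" using self by (auto simp: P_def N)
    show "{} \<notin> P" using self by (auto simp: P_def)
    fix p q assume "p \<in> P" "q \<in> P" "p \<noteq> q"
    then show "disjnt p q" using eq unfolding P_def disjnt_def by blast
  qed
  have parts: "has_parts G P"
    unfolding has_parts_def
  proof (intro conjI part ballI)
    fix u v assume uv: "u \<in> verts G" "v \<in> verts G"
    have "adjacent G u v \<longleftrightarrow> v \<notin> N u" using uv by (simp add: N)
    also have "\<dots> \<longleftrightarrow> (\<forall>A\<in>P. u \<in> A \<longrightarrow> v \<notin> A)"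
      using part_unique[OF part, of "N u" _ u] self[OF uv(1)] uv(1) by (auto simp: P_def)
    finally show "adjacent G u v \<longleftrightarrow> (\<forall>A\<in>P. u \<in> A \<longrightarrow> v \<notin> A)" .
  qed
  have finP: "finite P" using finite_verts by (simp add: P_def)
  have sizes: "card A = 1 \<or> card A = 2" if "A \<in> P" for A
  proof -
    obtain v where v: "v \<in> verts G" "A = N v" using \<open>A \<in> P\<close> by (auto simp: P_def)
    then have "card A \<noteq> 0" using self[OF v(1)] finN[of v] by auto
    moreover have "card A \<le> 2" using card2[OF v(1)] v(2) by simp
    ultimately show ?thesis by linarith
  qed
  have unique: "A = B" if "A \<in> P" "B \<in> P" "card A = 1" "card B = 1" for A B
  proof (rule ccontr)
    assume "A \<noteq> B"
    obtain u v where uv: "u \<in> verts G" "A = N u" "v \<in> verts G" "B = N v"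
      using \<open>A \<in> P\<close> \<open>B \<in> P\<close> by (auto simp: P_def)
    then have "N u = {u}" "N v = {v}" using that self by (metis card_1_singletonE singletonD)+
    then have "adjacent G u w \<or> w = u" "adjacent G v w \<or> w = v" if "w \<in> verts G" for w
      using that N[of w u] N[of w v] by auto
    then show False using no_two_dominating[of u v] uv \<open>A \<noteq> B\<close> by blast
  qed
  have "card P \<ge> 2"
  proof -
    obtain e where "e \<in> edges G" using has_edge by (auto simp: edgeless_def)
    then obtain u v where uv: "u \<in> verts G" "v \<in> verts G" "adjacent G u v"
      using edge_endpoints[OF simple] by metis
    then have "N u \<noteq> N v" using self[of v] by (auto simp: N)
    then have "card {N u, N v} = 2" by simp
    moreover have "{N u, N v} \<subseteq> P" using uv by (simp add: P_def)
    ultimately show ?thesis using card_mono[OF finP] by metis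
  qed
  moreover have "part_sizes P = replicate_mset (card P) 2 \<or>
      part_sizes P = add_mset 1 (replicate_mset (card P - 1) 2)"
  proof (cases "\<exists>A\<in>P. card A = 1")
    case True
    then obtain A where A: "A \<in> P" "card A = 1" by blast
    have "image_mset card (mset_set (P - {A})) = image_mset (\<lambda>_. 2) (mset_set (P - {A}))"
      using sizes unique[OF _ A(1) _ A(2)] finP by (intro image_mset_cong) auto
    then show ?thesis
      unfolding part_sizes_def mset_set.remove[OF finP A(1)]
      using A finP by (simp add: image_mset_const_eq)
  next
    case False
    then have "part_sizes P = image_mset (\<lambda>_. 2) (mset_set P)"
      unfolding part_sizes_def using sizes finP by (intro image_mset_cong) auto
    then show ?thesis by (simp add: image_mset_const_eq)
  qed
  ultimately show ?thesis using that parts by blast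
qed

lemma parts_of_minimally_tough_cograph:
  obtains P l where "has_parts G P" "l \<ge> 2"
    "part_sizes P = {#2, 3#} \<or> part_sizes P = {#1, l#} \<or> part_sizes P = replicate_mset l 2 \<or>
     part_sizes P = add_mset 1 (replicate_mset (l - 1) 2)"
proof -
  obtain S where SV: "S \<subseteq> verts G"
    and S: "\<forall>s\<in>S. \<forall>w\<in>verts G - S. adjacent G s w"
      "\<forall>v\<in>verts G - S. \<forall>w\<in>verts G - S. \<not> adjacent G v w"
    and small: "card S < 2 * t + 1"
    and sizes: "card S = 1 \<and> card (verts G - S) \<ge> 2 \<or>
     card S = 2 \<and> card (verts G - S) = 3 \<or>
     card S \<ge> 1 \<and> card (verts G - S) = 2"
    using independent_side by metis
  have join: "adjacent G s w" if "s \<in> S" "w \<in> verts G - S" for s w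
    using S(1) that by blast
  have indep: "\<not> adjacent G v w" if "v \<in> verts G - S" "w \<in> verts G - S" for v w
    using S(2) that by blast
  have ne: "S \<noteq> {}" "verts G - S \<noteq> {}"
    using sizes by (metis card.empty not_one_le_zero not_numeral_le_zero zero_neq_numeral zero_neq_one)+
  have parts: "has_parts G {S, verts G - S}"
    "part_sizes {S, verts G - S} = {#card S, card (verts G - S)#}"
    if "\<And>v w. v \<in> S \<Longrightarrow> w \<in> S \<Longrightarrow> \<not> adjacent G v w"
    using has_parts_of_join[OF SV ne join indep that] by simp_all
  show ?thesis
    using sizes
  proof (elim disjE conjE)
    assume S: "card S = 1" and m: "card (verts G - S) \<ge> 2"
    obtain s where "S = {s}" using S by (rule card_1_singletonE)
    then have "\<not> adjacent G v w" if "v \<in> S" "w \<in> S" for v w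
      using that not_adjacent_self[OF simple] by simp
    then show ?thesis using that[OF parts(1) m] parts(2) S by simp
  next
    assume S: "card S = 2" and m: "card (verts G - S) = 3"
    then obtain a b where ab: "S = {a, b}" "a \<noteq> b" by (auto simp: card_2_iff)
    have "\<not> adjacent G a b"
    proof
      assume "adjacent G a b"
      then show False
        using no_two_dominating[of a b] ab SV join
        by (metis DiffI adjacent_sym empty_iff insertE insertI1 insert_subset insertI2)
    qed
    then have "\<not> adjacent G v w" if "v \<in> S" "w \<in> S" for v w
      using that ab not_adjacent_self[OF simple] by (auto simp: adjacent_sym)
    then show ?thesis using that[OF parts(1), of 2] parts(2) S m by simp
  next
    assume m: "card (verts G - S) = 2"
    \<comment> \<open>From \<open>|S| < 2t + 1\<close> and \<open>n = |S| + 2\<close> one gets \<open>2t > n - 3\<close>, a lower bound on degrees.\<close>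
    have n: "card (verts G) = card S + 2"
      using card_Diff_subset[OF finite_subset[OF SV finite_verts] SV] m
        card_mono[OF finite_verts SV] by linarith
    have "card (verts G) \<le> card (neighbors G v) + 2" if v: "v \<in> verts G" for v
    proof (cases "\<exists>w\<in>verts G. w \<noteq> v \<and> \<not> adjacent G v w")
      case True
      then have "2 * t \<le> card (neighbors G v)" using nondominating_degree v by metis
      then show ?thesis using small n by linarith
    next
      case False
      then have "verts G - {v} \<subseteq> neighbors G v" by (auto simp: neighbors_def)
      then have "card (verts G - {v}) \<le> card (neighbors G v)"
        using finite_neighbors[OF simple] by (intro card_mono)
      then show ?thesis using v finite_verts by (simp add: card_Diff_singleton)
    qed
    then show ?thesis using parts_of_large_degrees that by metis
  qed
qed

end

theorem theorem1p1:
  fixes G :: "'a ugraph"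
  assumes "simple_graph G" and "P4_free G"
  shows "nontrivially_minimally_tough G \<longleftrightarrow>
    (\<exists>l::nat. l \<ge> 2 \<and>
       (G \<cong>\<^sub>g complete_bipartite 2 3 \<or>
        G \<cong>\<^sub>g complete_bipartite 1 l \<or>
        G \<cong>\<^sub>g turan_graph (2 * l) l \<or>
        G \<cong>\<^sub>g turan_graph (2 * l - 1) l))"
proof -
  have star: "G \<cong>\<^sub>g complete_bipartite 1 l \<longleftrightarrow> (\<exists>P. has_parts G P \<and> part_sizes P = {#1, l#})"
    if "l \<ge> 2" for l
    using iso_complete_bipartite_iff[OF assms(1)] that by simp
  have K23: "G \<cong>\<^sub>g complete_bipartite 2 3 \<longleftrightarrow> (\<exists>P. has_parts G P \<and> part_sizes P = {#2, 3#})"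
    using iso_complete_bipartite_iff[OF assms(1)] by simp
  have even: "G \<cong>\<^sub>g turan_graph (2 * l) l \<longleftrightarrow>
      (\<exists>P. has_parts G P \<and> part_sizes P = replicate_mset l 2)" if "l \<ge> 2" for l
    using iso_turan_iff[OF assms(1), of l "2 * l"] that by simp
  have odd: "G \<cong>\<^sub>g turan_graph (2 * l - 1) l \<longleftrightarrow>
      (\<exists>P. has_parts G P \<and> part_sizes P = add_mset 1 (replicate_mset (l - 1) 2))" if "l \<ge> 2" for l
  proof -
    have div: "(2 * l - 1) div l = 1" using that by (intro div_nat_eqI) simp_all
    moreover have "(2 * l - 1) mod l = l - 1"
      by (simp only: minus_div_mult_eq_mod[symmetric] div)
    moreover have "replicate_mset (l - 1) (Suc 1) + replicate_mset (l - (l - 1)) 1 =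
        add_mset 1 (replicate_mset (l - 1) 2)"
      using that by (simp add: numeral_2_eq_2)
    ultimately show ?thesis
      using iso_turan_iff[OF assms(1), of l "2 * l - 1"] that by simp
  qed
  have listed: "(G \<cong>\<^sub>g complete_bipartite 2 3 \<or> G \<cong>\<^sub>g complete_bipartite 1 l \<or>
        G \<cong>\<^sub>g turan_graph (2 * l) l \<or> G \<cong>\<^sub>g turan_graph (2 * l - 1) l) \<longleftrightarrow>
      (\<exists>P. has_parts G P \<and> (part_sizes P = {#2, 3#} \<or> part_sizes P = {#1, l#} \<or>
        part_sizes P = replicate_mset l 2 \<or> part_sizes P = add_mset 1 (replicate_mset (l - 1) 2)))"
    if "l \<ge> 2" for l
    unfolding K23 star[OF that] even[OF that] odd[OF that] by blast
  show ?thesis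
  proof
    assume nt: "nontrivially_minimally_tough G"
    then have nc: "\<not> complete_graph G" "\<not> edgeless G" "minimally_tough G"
      by (auto simp: nontrivially_minimally_tough_def)
    then obtain t :: real where t: "\<And>S. separator G S \<Longrightarrow> t * num_components (del_verts G S) \<le> card S"
      "\<And>e. e \<in> edges G \<Longrightarrow> \<exists>S. separator (del_edge G e) S \<and>
          card S < t * num_components (del_verts (del_edge G e) S)"
      using noncomplete_minimally_tough_iff[OF assms(1)] by blast
    interpret minimally_tough_cograph G t
      by unfold_locales (fact assms(1), erule (5) P4_freeD[OF assms], fact nc, fact nc, fact t(1), fact t(2))
    obtain P l where "has_parts G P" "l \<ge> 2"
      "part_sizes P = {#2, 3#} \<or> part_sizes P = {#1, l#} \<or> part_sizes P = replicate_mset l 2 \<or>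
       part_sizes P = add_mset 1 (replicate_mset (l - 1) 2)"
      by (rule parts_of_minimally_tough_cograph)
    then show "\<exists>l::nat. l \<ge> 2 \<and> (G \<cong>\<^sub>g complete_bipartite 2 3 \<or> G \<cong>\<^sub>g complete_bipartite 1 l \<or>
        G \<cong>\<^sub>g turan_graph (2 * l) l \<or> G \<cong>\<^sub>g turan_graph (2 * l - 1) l)"
      using listed by blast
  next
    assume "\<exists>l::nat. l \<ge> 2 \<and> (G \<cong>\<^sub>g complete_bipartite 2 3 \<or> G \<cong>\<^sub>g complete_bipartite 1 l \<or>
        G \<cong>\<^sub>g turan_graph (2 * l) l \<or> G \<cong>\<^sub>g turan_graph (2 * l - 1) l)"
    then obtain l P where l: "l \<ge> 2" and P: "has_parts G P"
      and sizes: "part_sizes P = {#2, 3#} \<or> part_sizes P = {#1, l#} \<or>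
        part_sizes P = replicate_mset l 2 \<or> part_sizes P = add_mset 1 (replicate_mset (l - 1) 2)"
      using listed by blast
    note intro = multipartite_minimally_tough[OF assms(1) P]
    show "nontrivially_minimally_tough G"
      using sizes
    proof (elim disjE)
      assume "part_sizes P = {#2, 3#}"
      then show ?thesis by (intro intro[of 2 1 3]) simp_all
    next
      assume "part_sizes P = {#1, l#}"
      then show ?thesis using l by (intro intro[of 1 1 l]) simp_all
    next
      assume "part_sizes P = replicate_mset l 2"
      then have "part_sizes P = add_mset 2 (replicate_mset (l - 1) 2)"
        using l by (metis Suc_diff_1 Suc_leD Suc_le_lessD numeral_2_eq_2 replicate_mset_Suc)
      then show ?thesis using l by (intro intro[of 2 "l - 1" 2]) simp_all
    next
      assume "part_sizes P = add_mset 1 (replicate_mset (l - 1) 2)"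
      then show ?thesis using l by (intro intro[of 1 "l - 1" 2]) simp_all
    qed
  qed
qed

end
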